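(* Let $S=(S^1,\dots,S^d)\in CS^d_n$ and $\Delta=(\Delta^1,\dots,\Delta^d)\in S^d_n$. Let $U$ be an $n\times n$ unitary matrix diagonalizing every component of $S$, chosen so that repeated joint eigenvalues appear consecutively, and write $$D^r:=U^*S^rU=\operatorname{diag}(x_1^r,\dots,x_n^r),\qquad x_i:=(x_i^1,\dots,x_i^d)\in\mathbb{R}^d .$$ For $1\le r\le d$ let $\Gamma^r:=U^*\Delta^rU$ and let $\tilde\Gamma^r$ be the $n\times n$ matrix with $\tilde\Gamma^r_{ij}=\Gamma^r_{ij}$ if $x_i=x_j$ and $\tilde\Gamma^r_{ij}=0$ otherwise. Then there exists a $C^1$ curve $S(t)$ in $CS^d_n$ with $S(0)=S$ and $S'(0)=\Delta$ if and only if $$[D^r,\Gamma^s]=[D^s,\Gamma^r]\quad\text{and}\quad[\tilde\Gamma^r,\tilde\Gamma^s]=0\qquad\text{for all }1\le r,s\le d.$$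
   Context: $S^d_n$ is the space of $d$-tuples of $n\times n$ self-adjoint (complex Hermitian) matrices. $CS^d_n\subset S^d_n$ is the set of $d$-tuples $S=(S^1,\dots,S^d)$ of pairwise-commuting self-adjoint matrices, i.e. $[S^r,S^s]=0$ for all $r,s$. $[A,B]=AB-BA$. Superscripts $r,s$ index components of tuples (they are not powers). A curve $S(t)$ in $CS^d_n$ with a condition at $t=0$ is understood to be defined on an interval around $0$; it is $C^1$ if it is continuously differentiable as a map into $S^d_n$. *)

theory Defs
  imports "HOL-Analysis.Analysis"
begin

(* A d-tuple of n x n complex matrices has type complex^'n^'n^'d; its r-th component is S $ r. *)

definition conj_transpose :: "complex^'n^'m \<Rightarrow> complex^'m^'n" where
  "conj_transpose A = (\<chi> i j. cnj (A $ j $ i))"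

definition self_adjoint :: "complex^'n^'n \<Rightarrow> bool" where
  "self_adjoint A \<longleftrightarrow> conj_transpose A = A"

definition unitary :: "complex^'n^'n \<Rightarrow> bool" where
  "unitary U \<longleftrightarrow> conj_transpose U ** U = mat 1 \<and> U ** conj_transpose U = mat 1"

definition commutator :: "complex^'n^'n \<Rightarrow> complex^'n^'n \<Rightarrow> complex^'n^'n" where
  "commutator A B = A ** B - B ** A"

definition diag_matrix :: "('n \<Rightarrow> complex) \<Rightarrow> complex^'n^'n" where
  "diag_matrix v = (\<chi> i j. if i = j then v i else 0)"

definition SA_tuples :: "(complex^'n^'n^'d) set" where
  "SA_tuples = {S. \<forall>r. self_adjoint (S $ r)}"

definition CS_tuples :: "(complex^'n^'n^'d) set" where
  "CS_tuples = {S \<in> SA_tuples. \<forall>r s. commutator (S $ r) (S $ s) = 0}"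

(* The linear order on the index type plays the role of the usual order on {1..n}. *)
definition repeated_consecutively :: "('n::linorder \<Rightarrow> 'a) \<Rightarrow> bool" where
  "repeated_consecutively x \<longleftrightarrow> (\<forall>i j k. i \<le> j \<and> j \<le> k \<and> x i = x k \<longrightarrow> x j = x i)"

definition joint_block_part :: "('n \<Rightarrow> 'a) \<Rightarrow> complex^'n^'n \<Rightarrow> complex^'n^'n" where
  "joint_block_part x G = (\<chi> i j. if x i = x j then G $ i $ j else 0)"

end

theory Submission
  imports Defs
begin

text \<open>
  Conjugation by \<open>U\<close> turns the question into one about curves through the diagonal tuple \<open>D\<close> with
  velocity \<open>\<Gamma>\<close>. The entries of \<open>[D\<^sup>r, A]\<close> are \<open>(x\<^sub>i\<^sup>r - x\<^sub>j\<^sup>r) A\<^sub>i\<^sub>j\<close>; in particular they vanish on the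
  diagonal blocks, where \<open>x\<^sub>i = x\<^sub>j\<close>.

  For necessity, write the curve as \<open>D\<^sup>r + t Q\<^sup>r(t)\<close> with \<open>Q\<^sup>r(t)\<close> converging to \<open>\<Gamma>\<^sup>r\<close>. Commutation,
  divided by \<open>t\<close>, reads \<open>[D\<^sup>r, Q\<^sup>s] - [D\<^sup>s, Q\<^sup>r] + t [Q\<^sup>r, Q\<^sup>s] = 0\<close>. The limit is the first condition. On
  the diagonal blocks the first two terms vanish identically, so \<open>[Q\<^sup>r, Q\<^sup>s]\<close> vanishes there and hence
  so does \<open>[\<Gamma>\<^sup>r, \<Gamma>\<^sup>s]\<close>: a condition of second order, although the curve is only differentiated once
  (\<open>commuting_curve_conditions\<close>). The first condition makes the vector \<open>(\<Gamma>\<^sup>r\<^sub>i\<^sub>k)\<^sub>r\<close> a multiple of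
  \<open>x\<^sub>k - x\<^sub>i\<close> whenever \<open>x\<^sub>i \<noteq> x\<^sub>k\<close>, so off-block entries contribute terms symmetric in \<open>r, s\<close> to the
  diagonal blocks of \<open>[\<Gamma>\<^sup>r, \<Gamma>\<^sup>s]\<close>, and what remains is the commutator of the block parts
  (\<open>joint_block_part_commutator\<close>).

  For sufficiency, the multiples just mentioned form a skew-Hermitian matrix \<open>C\<close>, and \<open>\<Gamma>\<^sup>r\<close> is its
  block part \<open>B\<^sup>r\<close> plus \<open>[C, D\<^sup>r]\<close> (\<open>compatible_split\<close>). The block parts commute with each other and
  with every \<open>D\<^sup>s\<close>, so \<open>D\<^sup>r + t B\<^sup>r\<close> is a commuting line; rotating it by a \<open>C\<^sup>1\<close> curve of
  unitaries \<open>W(t)\<close> with \<open>W(0) = 1\<close> and \<open>W'(0) = C\<close> adds the missing velocity \<open>[C, D\<^sup>r]\<close>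
  (\<open>commuting_curve_exists\<close>). The Cayley transform of \<open>C\<close> supplies such a \<open>W\<close>
  (\<open>unitary_curve_exists\<close>).
\<close>

section \<open>Matrix algebra\<close>

lemma conj_transpose_involution [simp]: "conj_transpose (conj_transpose A) = A"
  by (simp add: conj_transpose_def vec_eq_iff)

lemma conj_transpose_mult: "conj_transpose (A ** B) = conj_transpose B ** conj_transpose A"
  by (simp add: conj_transpose_def matrix_matrix_mult_def vec_eq_iff mult.commute)

lemma conj_transpose_add: "conj_transpose (A + B) = conj_transpose A + conj_transpose B"
  by (simp add: conj_transpose_def vec_eq_iff)

lemma conj_transpose_diff: "conj_transpose (A - B) = conj_transpose A - conj_transpose B"
  by (simp add: conj_transpose_def vec_eq_iff)

lemma conj_transpose_scaleR: "conj_transpose (c *\<^sub>R A) = c *\<^sub>R conj_transpose A"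
  by (simp add: conj_transpose_def vec_eq_iff)

lemma conj_transpose_mat_1 [simp]: "conj_transpose (mat 1) = mat 1"
  by (simp add: conj_transpose_def mat_def vec_eq_iff)

lemma bounded_linear_conj_transpose:
  "bounded_linear (conj_transpose :: complex^'n^'m \<Rightarrow> complex^'m^'n)"
  unfolding linear_conv_bounded_linear[symmetric]
  by (intro linearI conj_transpose_add conj_transpose_scaleR)

interpretation matrix_mult: bounded_bilinear "(**) :: complex^'n^'n \<Rightarrow> complex^'n^'n \<Rightarrow> complex^'n^'n"
  unfolding bilinear_conv_bounded_bilinear[symmetric] bilinear_def
  by (auto intro!: linearI simp: matrix_matrix_mult_def vec_eq_iff algebra_simps
        sum.distrib scaleR_sum_right)

lemma unitary_mult: "unitary U \<Longrightarrow> unitary V \<Longrightarrow> unitary (U ** V)"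
  unfolding unitary_def conj_transpose_mult by (metis matrix_mul_assoc matrix_mul_rid)

lemma unitary_conj_transpose: "unitary U \<Longrightarrow> unitary (conj_transpose U)"
  by (simp add: unitary_def)

lemma commutator_unitary_conjugation:
  assumes "unitary V"
  shows "commutator (V ** A ** conj_transpose V) (V ** B ** conj_transpose V)
         = V ** commutator A B ** conj_transpose V"
proof -
  have "(V ** X ** conj_transpose V) ** (V ** Y ** conj_transpose V) = V ** (X ** Y) ** conj_transpose V"
    for X Y
    using assms unfolding unitary_def by (metis matrix_mul_assoc matrix_mul_rid)
  then show ?thesis
    by (simp add: commutator_def matrix_mult.diff_left matrix_mult.diff_right)
qed

lemma self_adjoint_conjugation: "self_adjoint A \<Longrightarrow> self_adjoint (V ** A ** conj_transpose V)"
  by (simp add: self_adjoint_def conj_transpose_mult matrix_mul_assoc)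

lemma self_adjoint_diag_real: "self_adjoint (diag_matrix (\<lambda>i. complex_of_real (v i)))"
  by (auto simp: self_adjoint_def conj_transpose_def diag_matrix_def vec_eq_iff)

lemma self_adjoint_block_part: "self_adjoint G \<Longrightarrow> self_adjoint (joint_block_part x G)"
  by (auto simp: self_adjoint_def conj_transpose_def joint_block_part_def vec_eq_iff)

lemma commutator_diag_nth:
  "commutator (diag_matrix v) G $ i $ j = (v i - v j) * G $ i $ j"
  by (simp add: commutator_def diag_matrix_def matrix_matrix_mult_def if_distrib if_distribR
      sum.delta sum.delta' algebra_simps cong: if_cong)

lemma commutator_swap: "commutator A B = - commutator B A"
  by (simp add: commutator_def)

lemma commutator_add_left: "commutator (A + B) C = commutator A C + commutator B C"
  and commutator_add_right: "commutator C (A + B) = commutator C A + commutator C B"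
  and commutator_scaleR_left: "commutator (c *\<^sub>R A) C = c *\<^sub>R commutator A C"
  and commutator_scaleR_right: "commutator C (c *\<^sub>R A) = c *\<^sub>R commutator C A"
  by (simp_all add: commutator_def matrix_mult.add_left matrix_mult.add_right
      matrix_mult.scaleR_left matrix_mult.scaleR_right scaleR_diff_right)

lemma tendsto_commutator:
  assumes "(f \<longlongrightarrow> A) F" and "(g \<longlongrightarrow> B) F"
  shows "((\<lambda>t. commutator (f t) (g t)) \<longlongrightarrow> commutator A B) F"
  unfolding commutator_def by (intro tendsto_diff matrix_mult.tendsto assms)

section \<open>Derivatives as limits of difference quotients\<close>

text \<open>
  Both directions of the proof use this form of the derivative: commuting curves are analysed through
  their difference quotients, and the resolvent identity computes a difference quotient exactly.
\<close>

lemma has_vector_derivative_iff_quotient: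
  "(f has_vector_derivative f') (at x)
   \<longleftrightarrow> ((\<lambda>y. (1 / (y - x)) *\<^sub>R (f y - f x)) \<longlongrightarrow> f') (at x)"
proof -
  have "norm ((1 / norm (y - x)) *\<^sub>R (f y - (f x + (y - x) *\<^sub>R f')))
        = norm ((1 / (y - x)) *\<^sub>R (f y - f x) - f')" if "y \<noteq> x" for y
  proof -
    have "(1 / (y - x)) *\<^sub>R (f y - f x) - f' = (1 / (y - x)) *\<^sub>R (f y - (f x + (y - x) *\<^sub>R f'))"
      using that by (simp add: scaleR_diff_right scaleR_add_right)
    then show ?thesis by (simp only: norm_scaleR) simp
  qed
  then have "((\<lambda>y. norm ((1 / norm (y - x)) *\<^sub>R (f y - (f x + (y - x) *\<^sub>R f')))) \<longlongrightarrow> 0) (at x)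
      \<longleftrightarrow> ((\<lambda>y. norm ((1 / (y - x)) *\<^sub>R (f y - f x) - f')) \<longlongrightarrow> 0) (at x)"
    by (intro filterlim_cong refl) (auto simp: eventually_at_filter)
  then show ?thesis
    unfolding has_vector_derivative_def has_derivative_at2 tendsto_norm_zero_iff
    using Lim_null[of "\<lambda>y. (1 / (y - x)) *\<^sub>R (f y - f x)" f' "at x"]
    by (simp add: bounded_linear_scaleR_left)
qed

lemma has_vector_derivative_vec_lambda:
  assumes "\<And>r. (f r has_vector_derivative f' r) (at t)"
  shows "((\<lambda>t. \<chi> r. f r t) has_vector_derivative (\<chi> r. f' r)) (at t)"
proof -
  have "((\<lambda>y. \<chi> r. (1 / (y - t)) *\<^sub>R (f r y - f r t)) \<longlongrightarrow> (\<chi> r. f' r)) (at t)"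
    using assms unfolding has_vector_derivative_iff_quotient by (rule tendsto_vec_lambda)
  also have "(\<lambda>y. \<chi> r. (1 / (y - t)) *\<^sub>R (f r y - f r t))
      = (\<lambda>y. (1 / (y - t)) *\<^sub>R ((\<chi> r. f r y) - (\<chi> r. f r t)))"
    by (simp add: fun_eq_iff vec_eq_iff)
  finally show ?thesis unfolding has_vector_derivative_iff_quotient .
qed

section \<open>A unitary curve with prescribed skew-Hermitian velocity\<close>

text \<open>
  The real inner product on complex matrices is \<open>Re (tr (X\<^sup>* Y))\<close>, so the adjoint of left
  multiplication is left multiplication by the conjugate transpose. This lets skewness be used
  directly on matrices, without passing to vectors.
\<close>

lemma inner_matrix_mult_left:
  fixes A B X :: "complex^'n^'n"
  shows "(A ** B) \<bullet> X = B \<bullet> (conj_transpose A ** X)"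
proof -
  have swap: "(a * b) \<bullet> c = b \<bullet> (cnj a * c)" for a b c :: complex
    by (simp add: inner_complex_def algebra_simps)
  have "(A ** B) \<bullet> X = (\<Sum>i\<in>UNIV. \<Sum>k\<in>UNIV. \<Sum>j\<in>UNIV. B $ j $ k \<bullet> (cnj (A $ i $ j) * X $ i $ k))"
    by (simp add: inner_vec_def matrix_matrix_mult_def inner_sum_left swap)
  also have "\<dots> = (\<Sum>i\<in>UNIV. \<Sum>j\<in>UNIV. \<Sum>k\<in>UNIV. B $ j $ k \<bullet> (cnj (A $ i $ j) * X $ i $ k))"
    by (intro sum.cong refl sum.swap)
  also have "\<dots> = (\<Sum>j\<in>UNIV. \<Sum>i\<in>UNIV. \<Sum>k\<in>UNIV. B $ j $ k \<bullet> (cnj (A $ i $ j) * X $ i $ k))"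
    by (rule sum.swap)
  also have "\<dots> = (\<Sum>j\<in>UNIV. \<Sum>k\<in>UNIV. \<Sum>i\<in>UNIV. B $ j $ k \<bullet> (cnj (A $ i $ j) * X $ i $ k))"
    by (intro sum.cong refl sum.swap)
  also have "\<dots> = B \<bullet> (conj_transpose A ** X)"
    by (simp add: inner_vec_def matrix_matrix_mult_def inner_sum_right conj_transpose_def)
  finally show ?thesis .
qed

text \<open>
  Skewness makes \<open>C B\<close> orthogonal to \<open>B\<close>, so Pythagoras applies to \<open>B - C B\<close>. The bound gives both
  the invertibility of \<open>1 - C\<close> and a bound on its inverse that does not depend on \<open>C\<close>.
\<close>

lemma norm_le_norm_one_minus_skew_mult:
  fixes C B :: "complex^'n^'n"
  assumes "conj_transpose C = - C"
  shows "norm B \<le> norm ((mat 1 - C) ** B)"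
proof -
  have "(C ** B) \<bullet> B = - ((C ** B) \<bullet> B)"
    using inner_matrix_mult_left[of C B B]
    by (simp add: assms matrix_mult.minus_left inner_commute)
  then have orth: "(C ** B) \<bullet> B = 0" "B \<bullet> (C ** B) = 0"
    by (simp_all add: inner_commute)
  have "(norm ((mat 1 - C) ** B))\<^sup>2 = (norm B)\<^sup>2 + (norm (C ** B))\<^sup>2"
    by (simp add: power2_norm_eq_inner matrix_mult.diff_left inner_diff_left inner_diff_right
        orth)
  then have "(norm B)\<^sup>2 \<le> (norm ((mat 1 - C) ** B))\<^sup>2" by simp
  then show ?thesis by (rule power2_le_imp_le) simp
qed

lemma one_minus_skew_inverse:
  fixes C :: "complex^'n^'n"
  assumes "conj_transpose C = - C"
  obtains R where "(mat 1 - C) ** R = mat 1" "R ** (mat 1 - C) = mat 1"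
    "norm R \<le> norm (mat 1 :: complex^'n^'n)"
proof -
  let ?L = "\<lambda>B :: complex^'n^'n. (mat 1 - C) ** B"
  have lin: "linear ?L"
    by (intro linearI matrix_mult.add_right matrix_mult.scaleR_right)
  have "inj ?L"
    unfolding linear_injective_0[OF lin]
    using norm_le_norm_one_minus_skew_mult[OF assms] by (metis norm_le_zero_iff norm_zero)
  then have "surj ?L"
    by (rule linear_inj_imp_surj[OF lin])
  then obtain R where R: "(mat 1 - C) ** R = mat 1" by (metis surjD)
  show thesis
  proof
    show "R ** (mat 1 - C) = mat 1" using R matrix_left_right_inverse by blast
    show "norm R \<le> norm (mat 1 :: complex^'n^'n)"
      using norm_le_norm_one_minus_skew_mult[OF assms, of R] R by simp
  qed (rule R)
qed

text \<open>
  The curve is the Cayley transform \<open>W(t) = (1 + t K) (1 - t K)\<^sup>-\<^sup>1\<close> with \<open>K = C / 2\<close>, written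
  as \<open>2 R(t) - 1\<close> with the resolvent \<open>R(t) = (1 - t K)\<^sup>-\<^sup>1\<close>. The resolvent identity
  \<open>R(t) - R(s) = (t - s) R(t) K R(s)\<close> and the uniform bound on \<open>R\<close> give continuity, then
  the continuous derivative \<open>R K R\<close>.
\<close>

lemma unitary_curve_exists:
  fixes C :: "complex^'n^'n"
  assumes skew: "conj_transpose C = - C"
  obtains W W' :: "real \<Rightarrow> complex^'n^'n"
  where "\<And>t. unitary (W t)" "\<And>t. (W has_vector_derivative W' t) (at t)"
    "continuous_on UNIV W'" "W 0 = mat 1" "W' 0 = C"
proof -
  define K where "K = (1/2) *\<^sub>R C"
  let ?A = "\<lambda>t. mat 1 - t *\<^sub>R K"
  have skew_t: "conj_transpose (t *\<^sub>R K) = - (t *\<^sub>R K)" for t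
    by (simp add: K_def conj_transpose_scaleR skew)
  have "\<forall>t. \<exists>R. ?A t ** R = mat 1 \<and> R ** ?A t = mat 1 \<and> norm R \<le> norm (mat 1 :: complex^'n^'n)"
    using one_minus_skew_inverse[OF skew_t] by metis
  then obtain R where R: "?A t ** R t = mat 1" "R t ** ?A t = mat 1"
      "norm (R t) \<le> norm (mat 1 :: complex^'n^'n)" for t
    by metis
  have resolvent: "R t - R s = (t - s) *\<^sub>R (R t ** K ** R s)" for t s
  proof -
    have "R t - R s = R t ** (?A s ** R s) - (R t ** ?A t) ** R s"
      by (simp only: R matrix_mul_lid matrix_mul_rid)
    also have "\<dots> = R t ** (?A s - ?A t) ** R s"
      by (simp add: matrix_mul_assoc matrix_mult.diff_left matrix_mult.diff_right)
    also have "?A s - ?A t = (t - s) *\<^sub>R K"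
      by (simp add: scaleR_diff_left)
    finally show ?thesis
      by (simp only: matrix_mult.scaleR_left matrix_mult.scaleR_right)
  qed
  have "isCont R s" for s
  proof -
    obtain b where b: "norm (X ** Y) \<le> norm X * norm Y * b" "0 < b" for X Y :: "complex^'n^'n"
      using matrix_mult.pos_bounded by blast
    let ?m = "norm (mat 1 :: complex^'n^'n)"
    have "norm (R t - R s) \<le> \<bar>t - s\<bar> * (?m * norm K * b * ?m * b)" for t
    proof -
      have "norm (R t ** K ** R s) \<le> norm (R t) * norm K * b * norm (R s) * b"
        by (rule order_trans[OF b(1)])
           (intro mult_right_mono b(1) norm_ge_zero less_imp_le[OF b(2)])
      also have "\<dots> \<le> ?m * norm K * b * ?m * b"
        using b(2) by (intro mult_mono R(3) order_refl) (auto intro!: mult_nonneg_nonneg)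
      finally show ?thesis
        unfolding resolvent[of t s] norm_scaleR real_norm_def by (rule mult_left_mono) simp
    qed
    moreover have "((\<lambda>t. \<bar>t - s\<bar> * (?m * norm K * b * ?m * b)) \<longlongrightarrow> 0) (at s)"
      by (auto intro!: tendsto_eq_intros)
    ultimately have "((\<lambda>t. R t - R s) \<longlongrightarrow> 0) (at s)"
      by (rule Lim_null_comparison[OF always_eventually, OF allI])
    then show ?thesis
      unfolding isCont_def by (simp add: LIM_zero_iff)
  qed
  note contR = this
  have derivR: "(R has_vector_derivative R s ** K ** R s) (at s)" for s
  proof -
    have "((\<lambda>t. R t ** K ** R s) \<longlongrightarrow> R s ** K ** R s) (at s)"
      using contR[of s] unfolding isCont_def
      by (intro matrix_mult.tendsto tendsto_const)
    moreover have "\<forall>\<^sub>F t in at s. R t ** K ** R s = (1 / (t - s)) *\<^sub>R (R t - R s)"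
      unfolding resolvent by (auto simp: eventually_at_filter)
    ultimately show ?thesis
      unfolding has_vector_derivative_iff_quotient by (rule Lim_transform_eventually)
  qed
  define W where "W t = 2 *\<^sub>R R t - mat 1" for t
  define W' where "W' t = 2 *\<^sub>R (R t ** K ** R t)" for t
  have R0: "R 0 = mat 1" using R(1)[of 0] by simp
  show thesis
  proof (rule that[of W W'])
    fix t
    show "(W has_vector_derivative W' t) (at t)"
    proof -
      have "((\<lambda>t. 2 *\<^sub>R R t - mat 1) has_vector_derivative 2 *\<^sub>R (R t ** K ** R t) - 0) (at t)"
        by (intro has_vector_derivative_diff has_vector_derivative_const derivR
            bounded_linear.has_vector_derivative[OF bounded_linear_scaleR_right])
      then show ?thesis by (simp add: W_def[abs_def] W'_def)
    qed
    let ?S = "conj_transpose (R t)"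
    have adj: "conj_transpose (?A t) = mat 1 + t *\<^sub>R K"
      unfolding conj_transpose_diff skew_t by simp
    \<comment> \<open>Multiplying this by \<open>R\<close> and \<open>R\<^sup>*\<close> on either side gives \<open>2 R R\<^sup>* = R + R\<^sup>* = 2 R\<^sup>* R\<close>, which is the unitarity of \<open>2 R - 1\<close>.\<close>
    have sum2: "?A t + conj_transpose (?A t) = 2 *\<^sub>R mat 1"
      unfolding adj by (simp add: scaleR_2)
    have S1: "conj_transpose (?A t) ** ?S = mat 1" "?S ** conj_transpose (?A t) = mat 1"
      using R(1,2)[of t] by (metis conj_transpose_mult conj_transpose_mat_1)+
    have "2 *\<^sub>R (R t ** ?S) = R t ** (2 *\<^sub>R mat 1) ** ?S"
      by (simp only: matrix_mult.scaleR_left matrix_mult.scaleR_right matrix_mul_rid)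
    also have "\<dots> = R t ** ?A t ** ?S + R t ** (conj_transpose (?A t) ** ?S)"
      unfolding sum2[symmetric]
      by (simp only: matrix_mult.add_left matrix_mult.add_right matrix_mul_assoc)
    finally have RS: "2 *\<^sub>R (R t ** ?S) = R t + ?S"
      by (simp only: R S1 matrix_mul_lid matrix_mul_rid add.commute)
    have "2 *\<^sub>R (?S ** R t) = ?S ** (2 *\<^sub>R mat 1) ** R t"
      by (simp only: matrix_mult.scaleR_left matrix_mult.scaleR_right matrix_mul_rid)
    also have "\<dots> = ?S ** (?A t ** R t) + ?S ** conj_transpose (?A t) ** R t"
      unfolding sum2[symmetric]
      by (simp only: matrix_mult.add_left matrix_mult.add_right matrix_mul_assoc)
    finally have SR: "2 *\<^sub>R (?S ** R t) = R t + ?S"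
      by (simp only: R S1 matrix_mul_lid matrix_mul_rid add.commute)
    have expand: "(2 *\<^sub>R X - mat 1) ** (2 *\<^sub>R Y - mat 1) = mat 1"
      if "2 *\<^sub>R (X ** Y) = X + Y" for X Y :: "complex^'n^'n"
    proof -
      have "(2 *\<^sub>R X - mat 1) ** (2 *\<^sub>R Y - mat 1)
            = 2 *\<^sub>R (2 *\<^sub>R (X ** Y)) - 2 *\<^sub>R X - (2 *\<^sub>R Y - mat 1)"
        by (simp add: matrix_mult.diff_left matrix_mult.diff_right matrix_mult.scaleR_left
            matrix_mult.scaleR_right scaleR_diff_right)
      then show ?thesis by (simp add: that scaleR_add_right)
    qed
    have "conj_transpose (W t) = 2 *\<^sub>R ?S - mat 1"
      by (simp add: W_def conj_transpose_diff conj_transpose_scaleR)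
    then show "unitary (W t)"
      unfolding unitary_def W_def using expand[OF RS] expand[of ?S "R t"] SR
      by (simp add: add.commute)
  next
    show "continuous_on UNIV W'"
      unfolding W'_def using contR
      by (intro continuous_on_scaleR continuous_on_const matrix_mult.continuous_on)
         (auto simp: continuous_at_imp_continuous_on)
    show "W 0 = mat 1" by (simp add: W_def R0 scaleR_2)
    show "W' 0 = C" by (simp add: W'_def R0 K_def matrix_mult.scaleR_left matrix_mult.scaleR_right)
  qed
qed

section \<open>Splitting a compatible tuple\<close>

text \<open>
  The entry is the coefficient of the orthogonal projection of \<open>(G\<^sup>r\<^sub>i\<^sub>j)\<^sub>r\<close> onto \<open>x\<^sub>j - x\<^sub>i\<close>. Dividing
  \<open>G\<^sup>r\<^sub>i\<^sub>j\<close> by \<open>x\<^sub>j\<^sup>r - x\<^sub>i\<^sup>r\<close> for one suitable \<open>r\<close> would give the same value for compatible tuples, but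
  the projection avoids the choice of \<open>r\<close> and is visibly skew-Hermitian. On the blocks, where
  \<open>x\<^sub>i = x\<^sub>j\<close>, the quotient \<open>0 / 0\<close> evaluates to \<open>0\<close>.
\<close>

definition rotation_generator ::
  "('n \<Rightarrow> real^'d) \<Rightarrow> ('d \<Rightarrow> complex^'n^'n) \<Rightarrow> complex^'n^'n" where
  "rotation_generator x G = (\<chi> i j.
     (\<Sum>r\<in>UNIV. complex_of_real (x j $ r - x i $ r) * G r $ i $ j)
     / complex_of_real (\<Sum>r\<in>UNIV. (x j $ r - x i $ r)\<^sup>2))"

lemma rotation_generator_skew:
  assumes "\<And>r. self_adjoint (G r)"
  shows "conj_transpose (rotation_generator x G) = - rotation_generator x G"
proof -
  have G: "cnj (G r $ j $ i) = G r $ i $ j" for r i j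
    using assms[of r] by (auto simp: self_adjoint_def conj_transpose_def vec_eq_iff)
  have "(\<Sum>r\<in>UNIV. complex_of_real (x i $ r - x j $ r) * G r $ i $ j)
      = - (\<Sum>r\<in>UNIV. complex_of_real (x j $ r - x i $ r) * G r $ i $ j)" for i j
    unfolding sum_negf[symmetric] by (intro sum.cong refl) (simp add: algebra_simps)
  then show ?thesis
    by (simp add: rotation_generator_def conj_transpose_def vec_eq_iff cnj_sum G power2_commute
        del: of_real_diff) (simp add: power2_commute)
qed

text \<open>
  Entrywise, compatibility says \<open>(x\<^sub>i\<^sup>r - x\<^sub>j\<^sup>r) G\<^sup>s\<^sub>i\<^sub>j = (x\<^sub>i\<^sup>s - x\<^sub>j\<^sup>s) G\<^sup>r\<^sub>i\<^sub>j\<close>, that is, the vector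
  \<open>(G\<^sup>r\<^sub>i\<^sub>j)\<^sub>r\<close> is parallel to \<open>x\<^sub>j - x\<^sub>i\<close> and so equals its projection.
\<close>

lemma compatible_off_block_entry:
  fixes x :: "'n::finite \<Rightarrow> real^'d"
  assumes compat: "\<And>r s. commutator (diag_matrix (\<lambda>i. complex_of_real (x i $ r))) (G s)
      = commutator (diag_matrix (\<lambda>i. complex_of_real (x i $ s))) (G r)"
    and ne: "x i \<noteq> x j"
  shows "G s $ i $ j = rotation_generator x G $ i $ j * complex_of_real (x j $ s - x i $ s)"
proof -
  let ?d = "\<lambda>r. complex_of_real (x j $ r - x i $ r)"
  have parallel: "?d r * G s $ i $ j = ?d s * G r $ i $ j" for r
    using arg_cong[OF compat[of r s], of "\<lambda>M. - (M $ i $ j)"]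
    unfolding commutator_diag_nth by (simp add: algebra_simps)
  obtain r where "x i $ r \<noteq> x j $ r" using ne by (auto simp: vec_eq_iff)
  then have "0 < (\<Sum>r\<in>UNIV. (x j $ r - x i $ r)\<^sup>2)"
    by (intro sum_pos2[of UNIV r]) auto
  then have nz: "complex_of_real (\<Sum>r\<in>UNIV. (x j $ r - x i $ r)\<^sup>2) \<noteq> 0"
    by (metis less_irrefl of_real_eq_0_iff)
  have "(\<Sum>r\<in>UNIV. ?d r * G r $ i $ j) * ?d s = (\<Sum>r\<in>UNIV. ?d r * (?d s * G r $ i $ j))"
    unfolding sum_distrib_right by (simp add: mult_ac)
  also have "\<dots> = (\<Sum>r\<in>UNIV. ?d r * (?d r * G s $ i $ j))"
    by (simp only: parallel)
  also have "\<dots> = complex_of_real (\<Sum>r\<in>UNIV. (x j $ r - x i $ r)\<^sup>2) * G s $ i $ j"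
    unfolding of_real_sum sum_distrib_right by (simp add: power2_eq_square mult_ac)
  finally show ?thesis
    using nz by (simp add: rotation_generator_def divide_simps mult_ac del: of_real_sum)
qed

text \<open>
  A compatible velocity separates into motion of the eigenvalues inside the blocks and rotation of the
  joint eigenspaces.
\<close>

lemma compatible_split:
  fixes x :: "'n::finite \<Rightarrow> real^'d"
  assumes compat: "\<And>r s. commutator (diag_matrix (\<lambda>i. complex_of_real (x i $ r))) (G s)
      = commutator (diag_matrix (\<lambda>i. complex_of_real (x i $ s))) (G r)"
  shows "G s = joint_block_part x (G s)
      + commutator (rotation_generator x G) (diag_matrix (\<lambda>i. complex_of_real (x i $ s)))"
proof -
  have "G s $ i $ j = joint_block_part x (G s) $ i $ j
      + commutator (rotation_generator x G) (diag_matrix (\<lambda>i. complex_of_real (x i $ s))) $ i $ j"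
    for i j
    unfolding commutator_swap[of "rotation_generator x G"]
    using compatible_off_block_entry[OF compat, of i j s]
    by (cases "x i = x j") (simp_all add: joint_block_part_def commutator_diag_nth algebra_simps)
  then show ?thesis by (simp add: vec_eq_iff)
qed

text \<open>
  In the \<open>(i, j)\<close> entry with \<open>x\<^sub>i = x\<^sub>j\<close>, an intermediate index \<open>k\<close> with \<open>x\<^sub>k \<noteq> x\<^sub>i\<close> contributes
  \<open>c\<^sub>i\<^sub>k c\<^sub>k\<^sub>j (x\<^sub>k\<^sup>r - x\<^sub>i\<^sup>r) (x\<^sub>i\<^sup>s - x\<^sub>k\<^sup>s)\<close> to \<open>G\<^sup>r G\<^sup>s\<close>. This is symmetric in \<open>r\<close> and \<open>s\<close>, so it cancels in
  the commutator and only indices inside the block remain.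
\<close>

lemma joint_block_part_commutator:
  fixes x :: "'n::finite \<Rightarrow> real^'d"
  assumes compat: "\<And>r s. commutator (diag_matrix (\<lambda>i. complex_of_real (x i $ r))) (G s)
      = commutator (diag_matrix (\<lambda>i. complex_of_real (x i $ s))) (G r)"
  shows "joint_block_part x (commutator (G r) (G s))
       = commutator (joint_block_part x (G r)) (joint_block_part x (G s))"
proof -
  let ?B = "\<lambda>r. joint_block_part x (G r)"
  have same: "commutator (G r) (G s) $ i $ j = commutator (?B r) (?B s) $ i $ j" if eq: "x i = x j" for i j
  proof -
    have "G r $ i $ k * G s $ k $ j - G s $ i $ k * G r $ k $ j
        = ?B r $ i $ k * ?B s $ k $ j - ?B s $ i $ k * ?B r $ k $ j" for k
    proof (cases "x i = x k")
      case True
      then show ?thesis using eq by (simp add: joint_block_part_def)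
    next
      case False
      then have "x k \<noteq> x j" using eq by simp
      show ?thesis
        using False eq
        by (simp add: compatible_off_block_entry[OF compat False]
            compatible_off_block_entry[OF compat \<open>x k \<noteq> x j\<close>] joint_block_part_def algebra_simps)
    qed
    then show ?thesis
      by (simp add: commutator_def matrix_matrix_mult_def sum_subtractf[symmetric])
  qed
  have off: "commutator (?B r) (?B s) $ i $ j = 0" if "x i \<noteq> x j" for i j
    using that by (auto simp: commutator_def matrix_matrix_mult_def joint_block_part_def
        intro!: sum.neutral simp flip: sum_subtractf)
  show ?thesis
    using same off by (auto simp: vec_eq_iff joint_block_part_def)
qed

section \<open>Necessity\<close>

text \<open>
  Commutation forces more than its first derivative at \<open>0\<close> shows: on the blocks the terms of first
  order in \<open>t\<close> vanish for every \<open>t\<close>, not only in the limit, which exposes the term of second order.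
\<close>

lemma commuting_curve_conditions:
  fixes x :: "'n::finite \<Rightarrow> real^'d" and H :: "'d \<Rightarrow> real \<Rightarrow> complex^'n^'n"
  assumes "0 < \<epsilon>"
    and comm: "\<And>t r s. t \<in> {-\<epsilon><..<\<epsilon>} \<Longrightarrow> commutator (H r t) (H s t) = 0"
    and H0: "\<And>r. H r 0 = diag_matrix (\<lambda>i. complex_of_real (x i $ r))"
    and deriv: "\<And>r. (H r has_vector_derivative G r) (at 0)"
  shows "commutator (H r 0) (G s) = commutator (H s 0) (G r)"
    and "joint_block_part x (commutator (G r) (G s)) = 0"
proof -
  define Q where "Q r t = (1 / t) *\<^sub>R (H r t - H r 0)" for r t
  have Q: "(Q r \<longlongrightarrow> G r) (at 0)" for r
    using deriv[of r] unfolding has_vector_derivative_iff_quotient Q_def[abs_def] by simp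
  have near: "\<forall>\<^sub>F t in at 0. t \<in> {-\<epsilon><..<\<epsilon>} \<and> t \<noteq> 0"
    using \<open>0 < \<epsilon>\<close> eventually_at_topological[of _ "0::real" UNIV]
    by (auto intro!: exI[of _ "{-\<epsilon><..<\<epsilon>}"])
  have expansion: "commutator (H r 0) (Q s t) - commutator (H s 0) (Q r t)
      + t *\<^sub>R commutator (Q r t) (Q s t) = 0"
    if t: "t \<in> {-\<epsilon><..<\<epsilon>} \<and> t \<noteq> 0" for t
  proof -
    have HQ: "H r t = H r 0 + t *\<^sub>R Q r t" for r
      using t by (simp add: Q_def)
    have "0 = commutator (H r 0 + t *\<^sub>R Q r t) (H s 0 + t *\<^sub>R Q s t)"
      using comm[of t r s] t unfolding HQ[symmetric] by simp
    also have "\<dots> = commutator (H r 0) (H s 0) + t *\<^sub>R (commutator (H r 0) (Q s t)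
        - commutator (H s 0) (Q r t) + t *\<^sub>R commutator (Q r t) (Q s t))"
      unfolding commutator_swap[of "H s 0"]
      by (simp add: commutator_add_left commutator_add_right commutator_scaleR_left
          commutator_scaleR_right scaleR_add_right)
    also have "commutator (H r 0) (H s 0) = 0"
      using comm[of 0] \<open>0 < \<epsilon>\<close> by simp
    finally show ?thesis using t by simp
  qed
  have "((\<lambda>t. commutator (H r 0) (Q s t) - commutator (H s 0) (Q r t)
      + t *\<^sub>R commutator (Q r t) (Q s t)) \<longlongrightarrow>
      commutator (H r 0) (G s) - commutator (H s 0) (G r) + 0 *\<^sub>R commutator (G r) (G s)) (at 0)"
    by (intro tendsto_intros tendsto_commutator Q)
  moreover have "((\<lambda>t. commutator (H r 0) (Q s t) - commutator (H s 0) (Q r t)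
      + t *\<^sub>R commutator (Q r t) (Q s t)) \<longlongrightarrow> 0) (at 0)"
    by (rule tendsto_eventually) (rule eventually_mono[OF near expansion])
  ultimately have "commutator (H r 0) (G s) - commutator (H s 0) (G r) + 0 *\<^sub>R commutator (G r) (G s) = 0"
    by (intro tendsto_unique[OF trivial_limit_at]) 
  then show "commutator (H r 0) (G s) = commutator (H s 0) (G r)"
    by simp
  have "commutator (G r) (G s) $ i $ j = 0" if eq: "x i = x j" for i j
  proof -
    have "commutator (Q r t) (Q s t) $ i $ j = 0" if t: "t \<in> {-\<epsilon><..<\<epsilon>} \<and> t \<noteq> 0" for t
      using arg_cong[OF expansion[OF t], of "\<lambda>M. M $ i $ j"] t eq
      by (simp add: H0 commutator_diag_nth)
    then have "((\<lambda>t. commutator (Q r t) (Q s t) $ i $ j) \<longlongrightarrow> 0) (at 0)"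
      by (intro tendsto_eventually eventually_mono[OF near])
    moreover have "((\<lambda>t. commutator (Q r t) (Q s t) $ i $ j) \<longlongrightarrow> commutator (G r) (G s) $ i $ j) (at 0)"
      by (intro tendsto_vec_nth tendsto_commutator Q)
    ultimately show ?thesis
      by (intro tendsto_unique[OF trivial_limit_at])
  qed
  then show "joint_block_part x (commutator (G r) (G s)) = 0"
    by (simp add: joint_block_part_def vec_eq_iff)
qed

section \<open>Sufficiency\<close>

text \<open>
  The curve is \<open>U W(t) (D\<^sup>r + t B\<^sup>r) W(t)\<^sup>* U\<^sup>*\<close>, where \<open>B\<^sup>r\<close> is the block part of \<open>G\<^sup>r\<close> and \<open>W\<close> is a
  unitary curve generated by \<open>rotation_generator x G\<close>.
\<close>

lemma commuting_curve_exists: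
  fixes x :: "'n::finite \<Rightarrow> real^'d" and G :: "'d \<Rightarrow> complex^'n^'n"
  defines "D \<equiv> \<lambda>r. diag_matrix (\<lambda>i. complex_of_real (x i $ r))"
  assumes U: "unitary U"
    and sa: "\<And>r. self_adjoint (G r)"
    and compat: "\<And>r s. commutator (D r) (G s) = commutator (D s) (G r)"
    and block: "\<And>r s. commutator (joint_block_part x (G r)) (joint_block_part x (G s)) = 0"
  obtains \<gamma> :: "real \<Rightarrow> complex^'n^'n^'d"
  where "\<gamma> C1_differentiable_on UNIV" "\<And>t. \<gamma> t \<in> CS_tuples"
    "\<gamma> 0 = (\<chi> r. U ** D r ** conj_transpose U)"
    "(\<gamma> has_vector_derivative (\<chi> r. U ** G r ** conj_transpose U)) (at 0)"
proof -
  define B where "B r = joint_block_part x (G r)" for r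
  define C where "C = rotation_generator x G"
  have skew: "conj_transpose C = - C"
    unfolding C_def by (rule rotation_generator_skew[OF sa])
  obtain W W' where W: "\<And>t. unitary (W t)" "\<And>t. (W has_vector_derivative W' t) (at t)"
      "continuous_on UNIV W'" "W 0 = mat 1" "W' 0 = C"
    by (rule unitary_curve_exists[OF skew]) blast
  define V where "V t = U ** W t" for t
  define V' where "V' t = U ** W' t" for t
  define M where "M r t = D r + t *\<^sub>R B r" for r t
  define g where "g r t = V t ** M r t ** conj_transpose (V t)" for r t
  define g' where "g' r t = V t ** M r t ** conj_transpose (V' t)
      + (V t ** B r + V' t ** M r t) ** conj_transpose (V t)" for r t
  have dV: "(V has_vector_derivative V' t) (at t)" for t
    unfolding V_def[abs_def] V'_def
    by (rule bounded_linear.has_vector_derivative[OF matrix_mult.bounded_linear_right W(2)])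
  have dM: "(M r has_vector_derivative B r) (at t)" for r t
    unfolding M_def[abs_def] by (auto intro!: derivative_eq_intros)
  have dg: "(g r has_vector_derivative g' r t) (at t)" for r t
    unfolding g_def[abs_def] g'_def
    by (intro matrix_mult.has_vector_derivative dV dM
        bounded_linear.has_vector_derivative[OF bounded_linear_conj_transpose])
  have cV: "continuous_on UNIV V"
    using dV by (intro continuous_at_imp_continuous_on) (blast intro: has_vector_derivative_continuous)
  have cM: "continuous_on UNIV (M r)" for r
    using dM by (intro continuous_at_imp_continuous_on) (blast intro: has_vector_derivative_continuous)
  have cV': "continuous_on UNIV V'"
    unfolding V'_def[abs_def] by (intro matrix_mult.continuous_on continuous_on_const W(3))
  have cg': "continuous_on UNIV (g' r)" for r
    unfolding g'_def[abs_def]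
    by (intro continuous_on_add matrix_mult.continuous_on cV cV' cM continuous_on_const
        bounded_linear.continuous_on[OF bounded_linear_conj_transpose])
  have UV: "unitary (V t)" for t
    unfolding V_def by (rule unitary_mult[OF U W(1)])
  have DB: "commutator (D r) (B s) = 0" for r s
    by (simp add: vec_eq_iff D_def commutator_diag_nth B_def joint_block_part_def)
  have DD: "commutator (D r) (D s) = 0" for r s
    by (simp add: vec_eq_iff D_def commutator_diag_nth) (simp add: diag_matrix_def)
  have MM: "commutator (M r t) (M s t) = 0" for r s t
    using DB[of s r] DB[of r s] DD[of r s] block[of r s] commutator_swap[of "B r" "D s"]
    by (simp add: M_def B_def commutator_add_left commutator_add_right
        commutator_scaleR_left commutator_scaleR_right)
  have saM: "self_adjoint (M r t)" for r t
    using self_adjoint_diag_real[of "\<lambda>i. x i $ r"] self_adjoint_block_part[OF sa, of x r]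
    by (simp add: self_adjoint_def M_def D_def B_def conj_transpose_add conj_transpose_scaleR)
  have V0: "V 0 = U" "V' 0 = U ** C" "M r 0 = D r" for r
    by (simp_all add: V_def V'_def M_def W)
  have g'0: "g' r 0 = U ** G r ** conj_transpose U" for r
  proof -
    have "g' r 0 = U ** (B r + commutator C (D r)) ** conj_transpose U"
      by (simp add: g'_def V0 conj_transpose_mult skew commutator_def matrix_mul_assoc
          matrix_mult.add_left matrix_mult.add_right matrix_mult.diff_left matrix_mult.diff_right
          matrix_mult.minus_left matrix_mult.minus_right)
    then show ?thesis
      using compatible_split[of x G r] compat unfolding B_def C_def D_def by simp
  qed
  show thesis
  proof (rule that[of "\<lambda>t. \<chi> r. g r t"])
    show "(\<lambda>t. \<chi> r. g r t) C1_differentiable_on UNIV"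
      unfolding C1_differentiable_on_def
      by (intro exI[of _ "\<lambda>t. \<chi> r. g' r t"] conjI ballI has_vector_derivative_vec_lambda dg
          continuous_on_vec_lambda cg')
    show "(\<chi> r. g r t) \<in> CS_tuples" for t
      using MM saM
      by (auto simp: CS_tuples_def SA_tuples_def g_def commutator_unitary_conjugation[OF UV]
          intro: self_adjoint_conjugation)
    show "(\<chi> r. g r 0) = (\<chi> r. U ** D r ** conj_transpose U)"
      by (simp add: g_def V0)
    show "((\<lambda>t. \<chi> r. g r t) has_vector_derivative (\<chi> r. U ** G r ** conj_transpose U)) (at 0)"
      unfolding g'0[symmetric] by (intro has_vector_derivative_vec_lambda dg)
  qed
qed

section \<open>Velocities of commuting curves\<close>

theorem theorem2p3:
  fixes S \<Delta> :: "complex^('n::{finite,linorder})^('n::{finite,linorder})^'d"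
    and U :: "complex^('n::{finite,linorder})^('n::{finite,linorder})"
    and x :: "('n::{finite,linorder}) \<Rightarrow> real^'d"
    and D \<Gamma> \<Gamma>t :: "'d \<Rightarrow> complex^('n::{finite,linorder})^('n::{finite,linorder})"
  assumes "S \<in> CS_tuples"
    and "\<Delta> \<in> SA_tuples"
    and "unitary U"
    and "\<And>r. D r = conj_transpose U ** (S $ r) ** U"
    and "\<And>r. D r = diag_matrix (\<lambda>i. complex_of_real (x i $ r))"
    and "repeated_consecutively x"
    and "\<And>r. \<Gamma> r = conj_transpose U ** (\<Delta> $ r) ** U"
    and "\<And>r. \<Gamma>t r = joint_block_part x (\<Gamma> r)"
  shows "(\<exists>\<gamma> \<epsilon>. 0 < \<epsilon>
            \<and> \<gamma> C1_differentiable_on {-\<epsilon><..<\<epsilon>}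
            \<and> (\<forall>t\<in>{-\<epsilon><..<\<epsilon>}. \<gamma> t \<in> CS_tuples)
            \<and> \<gamma> 0 = S
            \<and> (\<gamma> has_vector_derivative \<Delta>) (at 0))
         \<longleftrightarrow> (\<forall>r s. commutator (D r) (\<Gamma> s) = commutator (D s) (\<Gamma> r)
                  \<and> commutator (\<Gamma>t r) (\<Gamma>t s) = 0)"
    (is "(\<exists>\<gamma> \<epsilon>. ?curve \<gamma> \<epsilon>) \<longleftrightarrow> (\<forall>r s. ?compat r s \<and> ?block r s)")
proof (intro iffI)
  have U: "unitary (conj_transpose U)" by (rule unitary_conj_transpose[OF assms(3)])
  assume "\<exists>\<gamma> \<epsilon>. ?curve \<gamma> \<epsilon>"
  then obtain \<gamma> \<epsilon> where curve: "?curve \<gamma> \<epsilon>" by blast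
  define H where "H r t = conj_transpose U ** (\<gamma> t $ r) ** U" for r t
  have comm: "commutator (H r t) (H s t) = 0" if "t \<in> {-\<epsilon><..<\<epsilon>}" for r s t
    using curve that commutator_unitary_conjugation[OF U, of "\<gamma> t $ r" "\<gamma> t $ s"]
    by (simp add: H_def CS_tuples_def)
  have H0: "H r 0 = D r" for r
    using curve by (simp add: H_def assms(4))
  have H0x: "H r 0 = diag_matrix (\<lambda>i. complex_of_real (x i $ r))" for r
    by (simp only: H0 assms(5))
  have deriv: "(H r has_vector_derivative \<Gamma> r) (at 0)" for r
    unfolding H_def[abs_def] assms(7)
    using curve
    by (intro bounded_linear.has_vector_derivative[OF matrix_mult.bounded_linear_left]
        bounded_linear.has_vector_derivative[OF matrix_mult.bounded_linear_right]
        bounded_linear.has_vector_derivative[OF bounded_linear_vec_nth]) blast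
  have eps: "0 < \<epsilon>" using curve by blast
  have compat: "?compat r s" for r s
    using commuting_curve_conditions(1)[where H = H and x = x, OF eps comm H0x deriv]
    by (simp only: H0)
  have "?block r s" for r s
    unfolding assms(8)
    using joint_block_part_commutator[of x \<Gamma> r s] compat
      commuting_curve_conditions(2)[where H = H and x = x, OF eps comm H0x deriv, of r s]
    unfolding assms(5) by simp
  with compat show "\<forall>r s. ?compat r s \<and> ?block r s" by blast
next
  assume *: "\<forall>r s. ?compat r s \<and> ?block r s"
  have undo: "U ** (conj_transpose U ** A ** U) ** conj_transpose U = A" for A
    using assms(3) unfolding unitary_def by (metis matrix_mul_assoc matrix_mul_lid matrix_mul_rid)
  have sa: "self_adjoint (\<Gamma> r)" for r
    using assms(2) self_adjoint_conjugation[of "\<Delta> $ r" "conj_transpose U"]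
    by (simp add: SA_tuples_def assms(7))
  obtain \<gamma> where \<gamma>: "\<gamma> C1_differentiable_on UNIV" "\<And>t. \<gamma> t \<in> CS_tuples"
    "\<gamma> 0 = (\<chi> r. U ** D r ** conj_transpose U)"
    "(\<gamma> has_vector_derivative (\<chi> r. U ** \<Gamma> r ** conj_transpose U)) (at 0)"
    using commuting_curve_exists[of U \<Gamma> x] assms(3) sa * unfolding assms(5,8) by blast
  have "\<gamma> 0 = S" "(\<gamma> has_vector_derivative \<Delta>) (at 0)"
    using \<gamma>(3,4) unfolding assms(4,7) undo by simp_all
  moreover have "\<gamma> C1_differentiable_on {-1<..<1}"
    using \<gamma>(1) by (rule C1_differentiable_on_subset) simp
  ultimately show "\<exists>\<gamma> \<epsilon>. ?curve \<gamma> \<epsilon>"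
    using \<gamma>(2) by (intro exI[of _ \<gamma>] exI[of _ 1]) simp
qed

end
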